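(* Every basic Novák space $X$ is Stäckel-compact.
   Context: Work in ZFC. A Hausdorff topological space $X$ is Stäckel-compact if there is a linear (total) order $\prec$ on the set $X$ such that every non-empty closed subset of $X$ has a $\prec$-least and a $\prec$-greatest element; $\prec$ is not assumed to be related to the topology of $X$ in any other way. Let $\beta(\mathbb{N})$ denote the Stone-Čech compactification of the discrete space $\mathbb{N}$ of positive integers. A subspace $X$ of $\beta(\mathbb{N})$ is called a basic Novák space if $X = \bigcup_{\xi<\omega_1} X_\xi$ for some $\omega_1$-sequence $\langle X_\xi\rangle_{\xi<\omega_1}$ of sets such that for all $\xi<\omega_1$: $\aleph_0 \le |X_\xi| \le 2^{\aleph_0}$; $X_\xi$ is disjoint from $\bigcup_{\mu<\xi} X_\mu$; and every infinite subset of $\bigcup_{\mu<\xi} X_\mu$ has a limit (accumulation) point in $X_\xi$. *)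

theory Defs
  imports "HOL-Analysis.Analysis"
begin

definition Staeckel_compact :: "'a topology \<Rightarrow> bool" where
  "Staeckel_compact X \<longleftrightarrow>
     Hausdorff_space X \<and>
     (\<exists>r. linear_order_on (topspace X) r \<and>
          (\<forall>C. closedin X C \<and> C \<noteq> {} \<longrightarrow>
               (\<exists>l\<in>C. \<forall>x\<in>C. (l, x) \<in> r) \<and>
               (\<exists>g\<in>C. \<forall>x\<in>C. (x, g) \<in> r)))"

(* The Stone-Cech compactification as Cech constructed it: the closure of the
   image of the evaluation map in the cube [0,1]^C(X,[0,1]).  Functions on the
   space are taken extensional, so that each continuous function on topspace X
   occurs exactly once as an index of the cube. *)

definition unit_maps :: "'a topology \<Rightarrow> ('a \<Rightarrow> real) set" where
  "unit_maps X =
     {f \<in> extensional (topspace X). continuous_map X (top_of_set {0..1}) f}"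

definition unit_cube :: "'a topology \<Rightarrow> (('a \<Rightarrow> real) \<Rightarrow> real) topology" where
  "unit_cube X = product_topology (\<lambda>_. top_of_set {0..1}) (unit_maps X)"

definition evaluation_map :: "'a topology \<Rightarrow> 'a \<Rightarrow> ('a \<Rightarrow> real) \<Rightarrow> real" where
  "evaluation_map X x = (\<lambda>f\<in>unit_maps X. f x)"

definition Stone_Cech :: "'a topology \<Rightarrow> (('a \<Rightarrow> real) \<Rightarrow> real) topology" where
  "Stone_Cech X =
     subtopology (unit_cube X)
       (unit_cube X closure_of (evaluation_map X ` topspace X))"

definition beta_N :: "((nat \<Rightarrow> real) \<Rightarrow> real) topology" where
  "beta_N = Stone_Cech (discrete_topology {n. 0 < n})"

(* The initial well-order of cardinality aleph_1: the ordinals below omega_1 are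
   represented by the elements of Field omega1, and underS omega1 xi is the set
   of all mu < xi. *)
definition omega1 :: "nat set rel" where
  "omega1 = cardSuc natLeq"

definition basic_Novak_space :: "((nat \<Rightarrow> real) \<Rightarrow> real) topology \<Rightarrow> bool" where
  "basic_Novak_space X \<longleftrightarrow>
     (\<exists>S. S \<subseteq> topspace beta_N \<and> X = subtopology beta_N S \<and>
       (\<exists>Xs. S = (\<Union>\<xi>\<in>Field omega1. Xs \<xi>) \<and>
         (\<forall>\<xi>\<in>Field omega1.
            (UNIV :: nat set) \<lesssim> Xs \<xi> \<and> Xs \<xi> \<lesssim> (UNIV :: nat set set) \<and>
            Xs \<xi> \<inter> (\<Union>\<mu>\<in>underS omega1 \<xi>. Xs \<mu>) = {} \<and>
            (\<forall>A. A \<subseteq> (\<Union>\<mu>\<in>underS omega1 \<xi>. Xs \<mu>) \<and> infinite A \<longrightarrow>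
                 Xs \<xi> \<inter> beta_N derived_set_of A \<noteq> {}))))"

end

theory Submission
  imports Defs
begin

text \<open>
  Let \<open>X\<close> be a basic Novak space and let \<open>\<cc>\<close> be the cardinality of the continuum.  It is enough to
  split \<open>X\<close> into two halves \<open>L\<close> and \<open>X - L\<close> such that every infinite closed set meets both: put \<open>L\<close>,
  well-ordered, below \<open>X - L\<close>, ordered by the converse of a well-order
  (\<open>Staeckel_compact_if_split\<close>).  An infinite closed set then has its least element in \<open>L\<close> and
  its greatest element in \<open>X - L\<close>, while finite sets are harmless in any linear order.

  The splitting is a Bernstein construction (\<open>ex_Bernstein_set\<close>): given at most \<open>\<cc>\<close> sets of
  cardinality at least \<open>\<cc>\<close>, transfinite recursion chooses two private points in each of them, and \<open>L\<close>
  takes one of the two.  The family consists of the sets of limit points of the countably infinite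
  subsets of \<open>X\<close>.  It has at most \<open>\<cc>\<close> members, as \<open>X\<close> has at most \<open>\<aleph>\<^sub>1 \<cdot> \<cc> = \<cc>\<close> points, and every
  infinite closed set includes a member.

  It remains to see that every infinite \<open>A \<subseteq> X\<close> has at least \<open>\<cc>\<close> limit points in \<open>X\<close>
  (\<open>continuum_many_limit_points\<close>).  View the points of \<open>\<beta>\<nat>\<close> as ultrafilters and choose points
  \<open>x\<^sub>n \<in> A\<close> and pairwise disjoint sets \<open>V\<^sub>n\<close> of integers with \<open>V\<^sub>n\<close> in the ultrafilter of \<open>x\<^sub>n\<close>.  There
  are \<open>\<cc>\<close> pairwise almost disjoint infinite sets \<open>S\<close> of indices, and each \<open>{x\<^sub>n | n \<in> S}\<close> has a limit
  point in \<open>X\<close>: being countable it lies below some level \<open>\<xi> < \<omega>\<^sub>1\<close>, hence has a limit point in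
  \<open>X\<^sub>\<xi>\<close>.  These limit points are distinct, because up to finitely many indices, which limit
  points ignore, two such \<open>S\<close> and \<open>T\<close> are disjoint, and so are the unions of the corresponding \<open>V\<^sub>n\<close>;
  no ultrafilter contains both unions.
\<close>

unbundle cardinal_syntax

section \<open>Cardinality and choice of representatives\<close>

text \<open>Representatives are chosen along a well-order of \<open>I\<close> of minimal type: fewer than \<open>|I|\<close> values
  have been used at any stage, so they cannot exhaust the next set.\<close>

lemma ex_injective_choice:
  assumes "\<And>i. i \<in> I \<Longrightarrow> |I| \<le>o |F i|"
  shows "\<exists>f. inj_on f I \<and> (\<forall>i\<in>I. f i \<in> F i)"
proof -
  define w where "w = |I|"
  have wo: "well_order_on I w"
    unfolding w_def by (rule card_of_well_order_on)
  let ?P = "\<lambda>f i y. i \<in> I \<longrightarrow> y \<in> F i - f ` underS w i"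
  have "\<exists>f. \<forall>i. ?P f i (f i)"
  proof (rule dependent_wf_choice)
    show "wf (w - Id)"
      using wo by (simp add: well_order_on_def)
  next
    fix f g :: "'a \<Rightarrow> 'b" and i y
    assume "\<And>z. (z, i) \<in> w - Id \<Longrightarrow> f z = g z"
    then have "f ` underS w i = g ` underS w i"
      by (intro image_cong) (auto simp: underS_def)
    then show "?P f i y = ?P g i y"
      by simp
  next
    fix i and f :: "'a \<Rightarrow> 'b"
    have "\<not> F i \<subseteq> f ` underS w i" if i: "i \<in> I"
    proof
      assume "F i \<subseteq> f ` underS w i"
      then have "|F i| \<le>o |underS w i|"
        using card_of_mono1 card_of_image ordLeq_transitive by blast
      also have "|underS w i| <o |I|"
        unfolding w_def using i by (intro card_of_underS[OF card_of_Card_order]) (simp add: Field_card_of)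
      finally have "|F i| <o |I|" .
      with assms[OF i] show False
        using not_ordLess_ordLeq by blast
    qed
    then show "\<exists>y. ?P f i y"
      by blast
  qed
  then obtain f where f: "\<And>i. i \<in> I \<Longrightarrow> f i \<in> F i - f ` underS w i"
    by blast
  have "inj_on f I"
  proof (rule inj_onI, rule ccontr)
    fix i j assume ij: "i \<in> I" "j \<in> I" "f i = f j" "i \<noteq> j"
    have "total_on I w"
      using wo by (simp add: order_on_defs)
    then have "i \<in> underS w j \<or> j \<in> underS w i"
      using ij by (auto simp: total_on_def underS_def)
    then show False
      using f[of i] f[of j] ij by (metis DiffD2 imageI)
  qed
  with f show ?thesis
    by blast
qed

lemma ex_Bernstein_set:
  assumes "infinite K" and "|I| \<le>o |K|" and F: "\<And>i. i \<in> I \<Longrightarrow> |K| \<le>o |F i|"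
  shows "\<exists>L. \<forall>i\<in>I. F i \<inter> L \<noteq> {} \<and> F i - L \<noteq> {}"
proof -
  \<comment> \<open>Two representatives of each set: the one indexed by \<open>True\<close> goes into \<open>L\<close>, the other stays out.\<close>
  let ?J = "I \<times> (UNIV :: bool set)"
  have "|UNIV :: bool set| \<le>o |K|"
    using assms(1) 
    by (intro ordLess_imp_ordLeq finite_ordLess_infinite card_of_Well_order) (auto simp: Field_card_of)
  then have "|?J| \<le>o |K|"
    using assms(1,2) by (intro card_of_Times_ordLeq_infinite_Field card_of_Card_order) (auto simp: Field_card_of)
  then have "\<exists>f. inj_on f ?J \<and> (\<forall>j\<in>?J. f j \<in> F (fst j))"
    by (intro ex_injective_choice) (use F ordLeq_transitive in fastforce)
  then obtain f where f: "inj_on f ?J" "\<And>i b. i \<in> I \<Longrightarrow> f (i, b) \<in> F i"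
    by fastforce
  have "f (i, False) \<notin> f ` (I \<times> {True})" if "i \<in> I" for i
    using f(1) that by (auto dest!: inj_onD)
  then show ?thesis
    using f(2) by (intro exI[of _ "f ` (I \<times> {True})"]) blast
qed

text \<open>The traces \<open>S \<inter> {..<n}\<close> of a set of natural numbers, each coded together with its bound \<open>n\<close>, so
  that there are infinitely many of them even if \<open>S\<close> is finite.  Distinct sets have only finitely many
  of them in common, which yields an almost disjoint family of size continuum.\<close>

definition initial_segments :: "nat set \<Rightarrow> nat set" where
  "initial_segments S = range (\<lambda>n. prod_encode (n, set_encode (S \<inter> {..<n})))"

lemma infinite_initial_segments: "infinite (initial_segments S)"
  unfolding initial_segments_def by (rule range_inj_infinite) (auto simp: inj_def)

text \<open>If \<open>k\<close> lies in exactly one of the two sets, only segments below \<open>k\<close> can be shared.\<close>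

lemma finite_Int_initial_segments:
  assumes "S \<noteq> T"
  shows "finite (initial_segments S \<inter> initial_segments T)"
proof -
  obtain k where k: "k \<in> S \<longleftrightarrow> k \<notin> T"
    using assms by blast
  have "initial_segments S \<inter> initial_segments T
          \<subseteq> (\<lambda>n. prod_encode (n, set_encode (S \<inter> {..<n}))) ` {..k}"
  proof
    fix x assume "x \<in> initial_segments S \<inter> initial_segments T"
    then obtain n where n: "x = prod_encode (n, set_encode (S \<inter> {..<n}))"
        "set_encode (S \<inter> {..<n}) = set_encode (T \<inter> {..<n})"
      by (auto simp: initial_segments_def)
    then have "S \<inter> {..<n} = T \<inter> {..<n}"
      using set_encode_eq by (metis finite_Int finite_lessThan)
    with k have "n \<le> k"
      by (metis Int_iff lessThan_iff not_le)
    with n show "x \<in> (\<lambda>n. prod_encode (n, set_encode (S \<inter> {..<n}))) ` {..k}"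
      by blast
  qed
  then show ?thesis
    by (rule finite_subset) simp
qed

text \<open>The slices of a set of codes of pairs: this is the bijection between
  \<open>2\<^sup>\<nat>\<close> and \<open>(2\<^sup>\<nat>)\<^sup>\<nat>\<close>.\<close>

definition slice :: "nat set \<Rightarrow> nat \<Rightarrow> nat set" where
  "slice t n = {k. prod_encode (n, k) \<in> t}"

lemma ex_slice: "\<exists>t. slice t = g"
proof
  show "slice {prod_encode (n, k) | n k. k \<in> g n} = g"
    by (auto simp: slice_def fun_eq_iff)
qed

section \<open>Ordering a space split into two halves\<close>

lemma finite_linear_order_least_greatest:
  assumes r: "linear_order_on A r" and "finite C" "C \<noteq> {}" "C \<subseteq> A"
  shows "(\<exists>l\<in>C. \<forall>x\<in>C. (l, x) \<in> r) \<and> (\<exists>g\<in>C. \<forall>x\<in>C. (x, g) \<in> r)"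
  using assms(2-)
proof (induction rule: finite_ne_induct)
  case (singleton x)
  then show ?case
    using r by (auto simp: order_on_defs refl_on_def)
next
  case (insert a C)
  then obtain l g where lg: "l \<in> C" "\<forall>x\<in>C. (l, x) \<in> r" "g \<in> C" "\<forall>x\<in>C. (x, g) \<in> r"
    by auto
  have tot: "(x, y) \<in> r \<or> (y, x) \<in> r" if "x \<in> A" "y \<in> A" for x y
    using r that by (cases "x = y") (auto simp: order_on_defs refl_on_def total_on_def)
  have tr: "(x, y) \<in> r \<Longrightarrow> (y, z) \<in> r \<Longrightarrow> (x, z) \<in> r" for x y z
    using r by (auto simp: order_on_defs trans_def)
  have A: "a \<in> A" "l \<in> A" "g \<in> A"
    using insert.prems lg by auto
  have "\<exists>l'\<in>insert a C. \<forall>x\<in>insert a C. (l', x) \<in> r"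
  proof (cases "(a, l) \<in> r")
    case True
    then have "\<forall>x\<in>insert a C. (a, x) \<in> r"
      using tot[OF A(1,1)] tr lg(2) by blast
    then show ?thesis by blast
  next
    case False
    then have "\<forall>x\<in>insert a C. (l, x) \<in> r"
      using tot[OF A(1,2)] lg(2) by blast
    then show ?thesis using lg(1) by blast
  qed
  moreover have "\<exists>g'\<in>insert a C. \<forall>x\<in>insert a C. (x, g') \<in> r"
  proof (cases "(g, a) \<in> r")
    case True
    then have "\<forall>x\<in>insert a C. (x, a) \<in> r"
      using tot[OF A(1,1)] tr lg(4) by blast
    then show ?thesis by blast
  next
    case False
    then have "\<forall>x\<in>insert a C. (x, g) \<in> r"
      using tot[OF A(1,3)] lg(4) by blast
    then show ?thesis using lg(3) by blast
  qed
  ultimately show ?case ..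
qed

lemma Staeckel_compact_if_split:
  assumes "Hausdorff_space X"
    and split: "\<And>C. closedin X C \<Longrightarrow> infinite C \<Longrightarrow> C \<inter> L \<noteq> {} \<and> C - L \<noteq> {}"
  shows "Staeckel_compact X"
proof -
  let ?A = "topspace X"
  obtain w where w: "well_order_on ?A w"
    using well_order_on by blast
  \<comment> \<open>\<open>L\<close> lies below its complement; on the complement the well-order is reversed.\<close>
  define r where "r = {(x, y) \<in> ?A \<times> ?A.
    (x \<in> L \<and> y \<notin> L) \<or> (x \<in> L \<and> y \<in> L \<and> (x, y) \<in> w) \<or> (x \<notin> L \<and> y \<notin> L \<and> (y, x) \<in> w)}"
  have w': "refl_on ?A w" "trans w" "antisym w" "total_on ?A w" "wf (w - Id)"
    using w by (auto simp: order_on_defs)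
  have lin: "linear_order_on ?A r"
    unfolding order_on_defs
  proof (intro conjI)
    show "r \<subseteq> ?A \<times> ?A"
      by (auto simp: r_def)
    show "refl_on ?A r"
      using w'(1) by (auto simp: r_def refl_on_def)
    show "trans r"
      using w'(2) unfolding trans_def r_def by blast
    show "antisym r"
      using w'(3) unfolding antisym_def r_def by blast
    show "total_on ?A r"
      using w'(4) unfolding total_on_def r_def by blast
  qed
  have least: "\<exists>l\<in>B. \<forall>x\<in>B. (l, x) \<in> w" if B: "B \<subseteq> ?A" "B \<noteq> {}" for B
  proof -
    obtain l where l: "l \<in> B" "\<And>y. (y, l) \<in> w - Id \<Longrightarrow> y \<notin> B"
      using w'(5) B(2) by (metis wfE_min all_not_in_conv)
    have "(l, x) \<in> w" if x: "x \<in> B" for x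
    proof (cases "x = l")
      case True
      then show ?thesis
        using w'(1) B x by (auto simp: refl_on_def)
    next
      case False
      then show ?thesis
        using w'(4) B x l unfolding total_on_def by blast
    qed
    with l show ?thesis
      by blast
  qed
  have "(\<exists>l\<in>C. \<forall>x\<in>C. (l, x) \<in> r) \<and> (\<exists>g\<in>C. \<forall>x\<in>C. (x, g) \<in> r)"
    if C: "closedin X C" "C \<noteq> {}" for C
  proof (cases "finite C")
    case True
    then show ?thesis
      using finite_linear_order_least_greatest[OF lin] C closedin_subset by blast
  next
    case False
    have CA: "C \<subseteq> ?A"
      using C closedin_subset by blast
    have "C \<inter> L \<noteq> {}" "C - L \<noteq> {}"
      using split C False by auto
    then obtain l g where "l \<in> C \<inter> L" "\<forall>x\<in>C \<inter> L. (l, x) \<in> w"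
        "g \<in> C - L" "\<forall>x\<in>C - L. (g, x) \<in> w"
      using least[of "C \<inter> L"] least[of "C - L"] CA by blast
    then have "\<forall>x\<in>C. (l, x) \<in> r" "\<forall>x\<in>C. (x, g) \<in> r" "l \<in> C" "g \<in> C"
      using CA by (auto simp: r_def)
    then show ?thesis
      by blast
  qed
  with lin assms(1) show ?thesis
    unfolding Staeckel_compact_def by blast
qed

text \<open>Every infinite closed set includes the set of limit points of an injective sequence of its
  points.  Sequences in \<open>X\<close> are indexed by sets of naturals, through an enumeration \<open>e\<close> of \<open>X\<close> by
  \<open>2\<^sup>\<nat>\<close> and the bijection \<open>slice\<close>, and a Bernstein set for these sets of limit points is a suitable
  lower half of the order.\<close>

lemma Staeckel_compact_if_many_limit_points:
  assumes "Hausdorff_space X" and card: "|topspace X| \<le>o |UNIV :: nat set set|"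
    and many: "\<And>A. A \<subseteq> topspace X \<Longrightarrow> infinite A \<Longrightarrow> |UNIV :: nat set set| \<le>o |X derived_set_of A|"
  shows "Staeckel_compact X"
proof (cases "topspace X = {}")
  case True
  then show ?thesis
    using assms(1) by (intro Staeckel_compact_if_split) (auto dest: closedin_subset)
next
  case False
  then obtain e :: "nat set \<Rightarrow> 'a" where e: "range e = topspace X"
    using card card_of_ordLeq2[of "topspace X" "UNIV :: nat set set"] by blast
  define I where "I = {t. infinite (range (e \<circ> slice t))}"
  define F where "F t = X derived_set_of (range (e \<circ> slice t))" for t
  have "|UNIV :: nat set set| \<le>o |F t|" if "t \<in> I" for t
    unfolding F_def using that e by (intro many) (auto simp: I_def)
  then have "\<exists>L. \<forall>t\<in>I. F t \<inter> L \<noteq> {} \<and> F t - L \<noteq> {}"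
    by (intro ex_Bernstein_set[of "UNIV :: nat set set"] card_of_mono1)
      (auto simp: Finite_Set.finite_set)
  then obtain L where L: "\<And>t. t \<in> I \<Longrightarrow> F t \<inter> L \<noteq> {} \<and> F t - L \<noteq> {}"
    by blast
  from assms(1) show ?thesis
  proof (rule Staeckel_compact_if_split)
    fix C assume C: "closedin X C" "infinite C"
    obtain c :: "nat \<Rightarrow> 'a" where c: "inj c" "range c \<subseteq> C"
      using C(2) infinite_countable_subset by blast
    have "\<exists>s. e s = c n" for n
    proof -
      have "c n \<in> range e"
        using c(2) closedin_subset[OF C(1)] e by auto
      then show ?thesis
        by auto
    qed
    then obtain g where g: "\<And>n. e (g n) = c n"
      by metis
    obtain t where t: "slice t = g"
      using ex_slice by blast
    have et: "e \<circ> slice t = c"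
      by (auto simp: t g)
    have "t \<in> I"
      unfolding I_def et mem_Collect_eq using c(1) by (rule range_inj_infinite)
    moreover have "F t \<subseteq> C"
      unfolding F_def et using derived_set_of_mono[OF c(2), of X] C(1)
      by (auto simp: closedin_contains_derived_set)
    ultimately show "C \<inter> L \<noteq> {} \<and> C - L \<noteq> {}"
      using L by blast
  qed
qed

section \<open>Points of \<open>\<beta>\<nat>\<close> as ultrafilters\<close>

text \<open>The characteristic function of \<open>W\<close>, as a coordinate of the cube in which \<open>\<beta>\<nat>\<close> lies; hence
  \<open>p (char_map W)\<close> is the value at \<open>p\<close> of its extension to \<open>\<beta>\<nat>\<close>.\<close>

definition char_map :: "nat set \<Rightarrow> nat \<Rightarrow> real" where
  "char_map W = (\<lambda>n\<in>{n. 0 < n}. if n \<in> W then 1 else 0)"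

text \<open>The ultrafilter of a point of \<open>\<beta>\<nat>\<close>: the sets whose extended characteristic function
  takes the value 1 there.  As this value is 0 or 1, it suffices to ask for more than 1/2.\<close>

definition ultrafilter_of :: "((nat \<Rightarrow> real) \<Rightarrow> real) \<Rightarrow> nat set set" where
  "ultrafilter_of p = {W. p (char_map W) > 1/2}"

abbreviation N_pos :: "nat topology" where
  "N_pos \<equiv> discrete_topology {n. 0 < n}"

lemma char_map_in_unit_maps: "char_map W \<in> unit_maps N_pos"
  by (auto simp: unit_maps_def char_map_def)

lemma Hausdorff_space_beta_N: "Hausdorff_space beta_N"
  unfolding beta_N_def Stone_Cech_def unit_cube_def
  by (intro Hausdorff_space_subtopology) (auto simp: Hausdorff_space_product_topology Hausdorff_space_subtopology)

lemma continuous_map_beta_N_char_map: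
  "continuous_map beta_N (top_of_set {0..1}) (\<lambda>q. q (char_map W))"
  unfolding beta_N_def Stone_Cech_def unit_cube_def
  by (intro continuous_map_from_subtopology continuous_map_product_projection char_map_in_unit_maps)

lemma openin_beta_N_char_map:
  assumes "open U"
  shows "openin beta_N {q \<in> topspace beta_N. q (char_map W) \<in> U}"
proof -
  have "continuous_map beta_N euclideanreal (\<lambda>q. q (char_map W))"
    using continuous_map_beta_N_char_map continuous_map_in_subtopology by blast
  then show ?thesis
    by (rule openin_continuous_map_preimage) (use assms in auto)
qed

lemma evaluation_map_char_map:
  assumes "0 < n"
  shows "evaluation_map N_pos n (char_map W) = (if n \<in> W then 1 else 0)"
  using assms by (simp add: evaluation_map_def char_map_in_unit_maps) (simp add: char_map_def)

lemma beta_N_dense: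
  assumes "openin beta_N U" "p \<in> U"
  shows "\<exists>n>0. evaluation_map N_pos n \<in> U"
proof -
  let ?D = "evaluation_map N_pos ` {n. 0 < n}"
  obtain V where V: "openin (unit_cube N_pos) V" "U = V \<inter> (unit_cube N_pos closure_of ?D)"
    using assms(1) by (auto simp: beta_N_def Stone_Cech_def openin_subtopology)
  then obtain n where n: "0 < n" "evaluation_map N_pos n \<in> V"
    using assms(2) by (auto simp: in_closure_of)
  have "f k \<in> {0..1}" if "f \<in> unit_maps N_pos" "0 < k" for f k
    using that by (auto simp: unit_maps_def)
  then have "evaluation_map N_pos k \<in> (\<Pi>\<^sub>E f\<in>unit_maps N_pos. {0..1})" if "0 < k" for k
    unfolding evaluation_map_def using that by (intro restrict_PiE_iff[THEN iffD2]) blast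
  then have "?D \<subseteq> topspace (unit_cube N_pos)"
    by (auto simp: unit_cube_def)
  then have "?D \<subseteq> unit_cube N_pos closure_of ?D"
    by (rule closure_of_subset)
  moreover have "evaluation_map N_pos n \<in> ?D"
    using n(1) by (intro imageI CollectI)
  ultimately have "evaluation_map N_pos n \<in> unit_cube N_pos closure_of ?D"
    by (rule subsetD)
  with n(2) have "evaluation_map N_pos n \<in> U"
    unfolding V(2) by (rule IntI)
  with n(1) show ?thesis
    by blast
qed

text \<open>On finitely many sets, the ultrafilter of \<open>p\<close> agrees with the principal ultrafilter of some
  \<open>n\<close> as close to \<open>p\<close> as desired.  All properties of the ultrafilters that are needed follow from
  this.\<close>

lemma ultrafilter_approx:
  assumes "openin beta_N U" "p \<in> U" "finite \<W>"
  shows "\<exists>n>0. evaluation_map N_pos n \<in> U \<and> (\<forall>W\<in>\<W>. W \<in> ultrafilter_of p \<longleftrightarrow> n \<in> W)"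
proof -
  define B where "B W = {q \<in> topspace beta_N. q (char_map W) \<in> ball (p (char_map W)) (1/2)}" for W
  have openB: "openin beta_N (B W)" for W
    unfolding B_def by (intro openin_beta_N_char_map open_ball)
  have p: "p \<in> topspace beta_N"
    using assms openin_subset by blast
  have "openin beta_N (U \<inter> (topspace beta_N \<inter> (\<Inter>W\<in>\<W>. B W)))"
  proof (cases "\<W> = {}")
    case False
    then have "openin beta_N (\<Inter>W\<in>\<W>. B W)"
      using assms(3) by (intro openin_Inter) (auto simp: openB)
    with assms(1) show ?thesis
      by (intro openin_Int openin_topspace)
  qed (use assms(1) in auto)
  moreover have "p \<in> U \<inter> (topspace beta_N \<inter> (\<Inter>W\<in>\<W>. B W))"
    using p assms(2) by (auto simp: B_def)
  ultimately have "\<exists>n>0. evaluation_map N_pos n \<in> U \<inter> (topspace beta_N \<inter> (\<Inter>W\<in>\<W>. B W))"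
    by (rule beta_N_dense)
  then obtain n where n: "0 < n" "evaluation_map N_pos n \<in> U"
      "\<And>W. W \<in> \<W> \<Longrightarrow> evaluation_map N_pos n \<in> B W"
    by auto
  have "W \<in> ultrafilter_of p \<longleftrightarrow> n \<in> W" if "W \<in> \<W>" for W
    using n(3)[OF that] n(1)
    by (auto simp: B_def ultrafilter_of_def evaluation_map_char_map dist_real_def abs_if split: if_splits)
  with n show ?thesis
    by blast
qed

lemma ultrafilter_approx':
  assumes "p \<in> topspace beta_N" "finite \<W>"
  shows "\<exists>n>0. \<forall>W\<in>\<W>. W \<in> ultrafilter_of p \<longleftrightarrow> n \<in> W"
  using ultrafilter_approx[of "topspace beta_N" p \<W>] assms by auto

lemma ultrafilter_mono:
  assumes "p \<in> topspace beta_N" "V \<in> ultrafilter_of p" "V \<subseteq> W"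
  shows "W \<in> ultrafilter_of p"
  using ultrafilter_approx'[of p "{V, W}"] assms by auto

lemma ultrafilter_disjoint:
  assumes "p \<in> topspace beta_N" "V \<in> ultrafilter_of p" "W \<in> ultrafilter_of p"
  shows "V \<inter> W \<noteq> {}"
  using ultrafilter_approx'[of p "{V, W}"] assms by auto

lemma ultrafilter_Int:
  assumes "p \<in> topspace beta_N" "V \<in> ultrafilter_of p" "W \<in> ultrafilter_of p"
  shows "V \<inter> W \<in> ultrafilter_of p"
  using ultrafilter_approx'[of p "{V, W, V \<inter> W}"] assms by auto

lemma ultrafilter_Diff:
  assumes "p \<in> topspace beta_N" "V \<in> ultrafilter_of p" "W \<notin> ultrafilter_of p"
  shows "V - W \<in> ultrafilter_of p"
  using ultrafilter_approx'[of p "{V, W, V - W}"] assms by auto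

lemma UNIV_in_ultrafilter: "p \<in> topspace beta_N \<Longrightarrow> UNIV \<in> ultrafilter_of p"
  using ultrafilter_approx'[of p "{UNIV}"] by auto

lemma ultrafilter_separates:
  assumes pq: "p \<in> topspace beta_N" "q \<in> topspace beta_N" "p \<noteq> q"
  shows "\<exists>W. W \<in> ultrafilter_of p \<and> W \<notin> ultrafilter_of q"
proof -
  obtain U V where UV: "openin beta_N U" "openin beta_N V" "p \<in> U" "q \<in> V" "disjnt U V"
    using Hausdorff_space_beta_N pq by (meson Hausdorff_space_def)
  define W where "W = {n. evaluation_map N_pos n \<in> U}"
  have "W \<in> ultrafilter_of p"
    using ultrafilter_approx[OF UV(1,3), of "{W}"] by (auto simp: W_def)
  moreover have "W \<notin> ultrafilter_of q"
    using ultrafilter_approx[OF UV(2,4), of "{W}"] UV(5) by (auto simp: W_def disjnt_iff)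
  ultimately show ?thesis
    by blast
qed

text \<open>The points whose ultrafilter contains \<open>W\<close> form a closed set.\<close>

lemma ultrafilter_limit_point:
  assumes p: "p \<in> beta_N derived_set_of D" and D: "\<And>x. x \<in> D \<Longrightarrow> W \<in> ultrafilter_of x"
  shows "W \<in> ultrafilter_of p"
proof (rule ccontr)
  assume W: "W \<notin> ultrafilter_of p"
  have pt: "p \<in> topspace beta_N"
    using p by (simp add: in_derived_set_of)
  \<comment> \<open>On the dense set of principal ultrafilters the coordinate takes only the values 0 and 1.\<close>
  have "p (char_map W) \<noteq> 1/2"
  proof
    assume eq: "p (char_map W) = 1/2"
    let ?U = "{q \<in> topspace beta_N. q (char_map W) \<in> {1/4<..<3/4}}"
    have "openin beta_N ?U"
      by (rule openin_beta_N_char_map) auto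
    then obtain n where "0 < n" "evaluation_map N_pos n \<in> ?U"
      using beta_N_dense[of ?U p] pt eq by auto
    then show False
      by (auto simp: evaluation_map_char_map split: if_splits)
  qed
  with W have "p (char_map W) < 1/2"
    by (auto simp: ultrafilter_of_def)
  moreover define U where "U = {q \<in> topspace beta_N. q (char_map W) \<in> {..<1/2}}"
  ultimately have "p \<in> U"
    using pt by simp
  moreover have "openin beta_N U"
    unfolding U_def by (rule openin_beta_N_char_map) auto
  ultimately obtain x where "x \<in> D" "x \<in> U"
    using p by (meson in_derived_set_of)
  then have x: "x \<in> D" "x (char_map W) < 1/2"
    by (simp_all add: U_def)
  then show False
    using D[of x] by (simp add: ultrafilter_of_def)
qed

section \<open>Many limit points\<close>

text \<open>If \<open>B\<close> belongs to the ultrafilters of infinitely many points of \<open>A\<close>, two of these points can be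
  separated by some \<open>W\<close>, and one of \<open>B \<inter> W\<close> and \<open>B - W\<close> still belongs to infinitely many of the ultrafilters.  Keep that
  half, and split off a point whose ultrafilter contains the other half.\<close>

lemma ex_separated_sequence:
  assumes A: "A \<subseteq> topspace beta_N" "infinite A"
  shows "\<exists>x V. (\<forall>n::nat. x n \<in> A \<and> V n \<in> ultrafilter_of (x n)) \<and> (\<forall>m n. m \<noteq> n \<longrightarrow> V m \<inter> V n = {})"
proof -
  let ?A = "\<lambda>B. {p \<in> A. B \<in> ultrafilter_of p}"
  let ?P = "\<lambda>B x C. C \<subseteq> B \<and> x \<in> A \<and> B - C \<in> ultrafilter_of x \<and> infinite (?A C)"
  have step: "\<exists>x C. ?P B x C" if B: "infinite (?A B)" for B
  proof -
    obtain p where p: "p \<in> ?A B"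
      using B by (metis ex_in_conv finite.emptyI)
    obtain q where q: "q \<in> ?A B" "q \<noteq> p"
      using infinite_remove[OF B, of p] by (metis (no_types, lifting) DiffE ex_in_conv finite.emptyI insertI1)
    obtain W where W: "W \<in> ultrafilter_of p" "W \<notin> ultrafilter_of q"
      using ultrafilter_separates[of p q] p q A by auto
    have "?A B \<subseteq> ?A (B \<inter> W) \<union> ?A (B - W)"
      using A(1) ultrafilter_Int ultrafilter_Diff by blast
    then consider "infinite (?A (B \<inter> W))" | "infinite (?A (B - W))"
      using B finite_subset by blast
    then show ?thesis
    proof cases
      case 1
      have "B - B \<inter> W \<in> ultrafilter_of q"
        using ultrafilter_Diff[of q B W] q W A by (auto simp: Diff_Int)
      with 1 q show ?thesis
        by blast
    next
      case 2
      have "B - (B - W) \<in> ultrafilter_of p"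
        using ultrafilter_Int[of p B W] p W A by (auto simp: Diff_Diff_Int)
      with 2 p show ?thesis
        by blast
    qed
  qed
  have "?A UNIV = A"
    using A(1) UNIV_in_ultrafilter by auto
  then have "infinite (?A UNIV)"
    using A(2) by simp
  then have "\<exists>B. \<forall>n. infinite (?A (B n)) \<and> (\<exists>x. ?P (B n) x (B (Suc n)))"
    by (intro dependent_nat_choice[where P = "\<lambda>_ B. infinite (?A B)"
          and Q = "\<lambda>_ B C. \<exists>x. ?P B x C"]) (use step in blast)+
  then obtain B where "\<forall>n. \<exists>x. ?P (B n) x (B (Suc n))"
    by blast
  then have "\<exists>x. \<forall>n. ?P (B n) (x n) (B (Suc n))"
    by (rule choice)
  then obtain x where B: "\<And>n. ?P (B n) (x n) (B (Suc n))"
    by blast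
  define V where "V n = B n - B (Suc n)" for n
  have anti: "B n \<subseteq> B m" if "m \<le> n" for m n
    using _ that by (rule lift_Suc_antimono_le) (use B in simp)
  have "V m \<inter> V n = {}" if "m < n" for m n
    using anti[of "Suc m" n] that by (auto simp: V_def)
  then have "V m \<inter> V n = {}" if "m \<noteq> n" for m n
    using that by (metis inf_commute nat_neq_iff)
  moreover have "x n \<in> A \<and> V n \<in> ultrafilter_of (x n)" for n
    using B[of n] by (simp add: V_def)
  ultimately show ?thesis
    by (intro exI[of _ x] exI[of _ V]) simp
qed

text \<open>As \<open>\<beta>\<nat>\<close> is a T1 space, finitely many points may be removed without affecting limit points; so \<open>S\<close>
  and \<open>T\<close> may be taken to be disjoint.\<close>

lemma disjoint_limit_points:
  assumes x: "\<And>n::nat. x n \<in> topspace beta_N" "\<And>n. V n \<in> ultrafilter_of (x n)"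
    and V: "\<And>m n. m \<noteq> n \<Longrightarrow> V m \<inter> V n = {}"
    and ST: "finite (S \<inter> T)"
    and p: "p \<in> beta_N derived_set_of (x ` S)" "p \<in> beta_N derived_set_of (x ` T)"
  shows False
proof -
  have pt: "p \<in> topspace beta_N"
    using p by (simp add: in_derived_set_of)
  have main: "(\<Union>i\<in>R - S \<inter> T. V i) \<in> ultrafilter_of p" if R: "p \<in> beta_N derived_set_of (x ` R)" for R
  proof (rule ultrafilter_limit_point)
    have "x ` R \<subseteq> x ` (R - S \<inter> T) \<union> x ` (S \<inter> T)"
      by blast
    then have "p \<in> beta_N derived_set_of (x ` (R - S \<inter> T)) \<union> beta_N derived_set_of (x ` (S \<inter> T))"
      unfolding derived_set_of_Un[symmetric] by (rule subsetD[OF derived_set_of_mono R])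
    moreover have "beta_N derived_set_of (x ` (S \<inter> T)) = {}"
      using Hausdorff_imp_t1_space[OF Hausdorff_space_beta_N] ST
      by (simp add: t1_space_derived_set_of_finite)
    ultimately show "p \<in> beta_N derived_set_of (x ` (R - S \<inter> T))"
      by simp
  next
    fix y assume "y \<in> x ` (R - S \<inter> T)"
    then obtain i where i: "i \<in> R - S \<inter> T" "y = x i"
      by (rule imageE)
    then have "V i \<subseteq> (\<Union>i\<in>R - S \<inter> T. V i)"
      by blast
    then show "(\<Union>i\<in>R - S \<inter> T. V i) \<in> ultrafilter_of y"
      unfolding i(2) by (rule ultrafilter_mono[OF x])
  qed
  have "(\<Union>i\<in>S - S \<inter> T. V i) \<inter> (\<Union>i\<in>T - S \<inter> T. V i) = {}"
  proof (rule equals0I)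
    fix n assume "n \<in> (\<Union>i\<in>S - S \<inter> T. V i) \<inter> (\<Union>i\<in>T - S \<inter> T. V i)"
    then obtain i j where "i \<in> S - S \<inter> T" "j \<in> T - S \<inter> T" "n \<in> V i" "n \<in> V j"
      by (elim IntE UN_E)
    then show False
      using V[of i j] by auto
  qed
  with ultrafilter_disjoint[OF pt main[OF p(1)] main[OF p(2)]] show False
    by (rule notE)
qed

lemma continuum_many_limit_points:
  assumes X: "X \<subseteq> topspace beta_N"
    and cc: "\<And>D. D \<subseteq> X \<Longrightarrow> countable D \<Longrightarrow> infinite D \<Longrightarrow> X \<inter> beta_N derived_set_of D \<noteq> {}"
    and A: "A \<subseteq> X" "infinite A"
  shows "|UNIV :: nat set set| \<le>o |X \<inter> beta_N derived_set_of A|"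
proof -
  have At: "A \<subseteq> topspace beta_N"
    using A(1) X by (rule subset_trans)
  obtain x V where "\<forall>n::nat. x n \<in> A \<and> V n \<in> ultrafilter_of (x n)"
      "\<forall>m n. m \<noteq> n \<longrightarrow> V m \<inter> V n = {}"
    using ex_separated_sequence[OF At A(2)] by (elim exE conjE) (rule that)
  then have xV: "\<And>n. x n \<in> A" "\<And>n. V n \<in> ultrafilter_of (x n)"
      "\<And>m n. m \<noteq> n \<Longrightarrow> V m \<inter> V n = {}"
    by simp_all
  have xt: "x n \<in> topspace beta_N" for n
    using At xV(1) by (rule subsetD)
  have "inj x"
  proof (rule injI, rule ccontr)
    fix m n assume "x m = x n" "m \<noteq> n"
    then show False
      using ultrafilter_disjoint[OF xt[of m], of "V m" "V n"] xV(2)[of m] xV(2)[of n] xV(3) by simp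
  qed
  have "X \<inter> beta_N derived_set_of (x ` initial_segments S) \<noteq> {}" for S
  proof (rule cc)
    show "infinite (x ` initial_segments S)"
      using infinite_initial_segments finite_imageD[OF _ inj_on_subset[OF \<open>inj x\<close> subset_UNIV]] by auto
    show "x ` initial_segments S \<subseteq> X"
      using xV(1) A(1) by (simp add: image_subset_iff subsetD)
  qed simp
  then have "\<forall>S. \<exists>p. p \<in> X \<inter> beta_N derived_set_of (x ` initial_segments S)"
    unfolding ex_in_conv by simp
  then have "\<exists>f. \<forall>S. f S \<in> X \<inter> beta_N derived_set_of (x ` initial_segments S)"
    by (rule choice)
  then obtain f where f: "\<And>S. f S \<in> X \<inter> beta_N derived_set_of (x ` initial_segments S)"
    by (elim exE) (rule that, erule spec)
  have "inj f"
  proof (rule injI, rule ccontr)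
    fix S T assume ST: "f S = f T" "S \<noteq> T"
    show False
      by (rule disjoint_limit_points[OF xt xV(2,3) finite_Int_initial_segments[OF ST(2)]
            IntD2[OF f] IntD2[OF f[of T, folded ST(1)]]])
  qed
  moreover have "f S \<in> X \<inter> beta_N derived_set_of A" for S
  proof -
    have "x ` initial_segments S \<subseteq> A"
      using xV(1) by (simp add: image_subset_iff)
    then show ?thesis
      by (rule subsetD[OF Int_mono[OF subset_refl derived_set_of_mono] f])
  qed
  ultimately show ?thesis
    by (rule card_of_ordLeqI)
qed

section \<open>Basic Novak spaces\<close>

lemma omega1_Card_order: "Card_order omega1"
  unfolding omega1_def by (intro cardSuc_Card_order natLeq_Card_order)

lemma omega1_ordLeq_continuum: "|Field omega1| \<le>o |UNIV :: nat set set|"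
proof -
  have "|UNIV :: nat set| <o |UNIV :: nat set set|"
    using card_of_Pow[of "UNIV :: nat set"] by simp
  then have "natLeq <o |UNIV :: nat set set|"
    by (rule ordIso_ordLess_trans[OF ordIso_symmetric[OF card_of_nat]])
  then have "omega1 \<le>o |UNIV :: nat set set|"
    unfolding omega1_def by (intro cardSuc_least natLeq_Card_order card_of_Card_order)
  then show ?thesis
    using card_of_Field_ordIso[OF omega1_Card_order] ordIso_ordLeq_trans by blast
qed

text \<open>This is the regularity of \<open>\<omega>\<^sub>1\<close>.\<close>

lemma countable_subset_bounded:
  assumes D: "D \<subseteq> (\<Union>\<xi>\<in>Field omega1. Xs \<xi>)" "countable D"
  shows "\<exists>\<xi>\<in>Field omega1. D \<subseteq> (\<Union>\<mu>\<in>underS omega1 \<xi>. Xs \<mu>)"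
proof -
  let ?Y = "\<lambda>\<xi>. \<Union>\<mu>\<in>underS omega1 \<xi>. Xs \<mu>"
  have inf: "infinite (Field natLeq)"
    by (simp add: Field_natLeq)
  have "Well_order omega1"
    using omega1_Card_order by (simp add: card_order_on_def)
  then have tr: "trans omega1" "antisym omega1"
    by (auto simp: order_on_defs)
  have "relChain omega1 ?Y"
    unfolding relChain_def
  proof (intro allI impI)
    fix i j assume "(i, j) \<in> omega1"
    then have "underS omega1 i \<subseteq> underS omega1 j"
      by (rule underS_incr[OF tr])
    then show "?Y i \<le> ?Y j"
      by blast
  qed
  moreover have "D \<subseteq> (\<Union>\<xi>\<in>Field omega1. ?Y \<xi>)"
  proof
    fix d assume "d \<in> D"
    then obtain \<mu> where \<mu>: "\<mu> \<in> Field omega1" "d \<in> Xs \<mu>"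
      using D by blast
    have "infinite (Field omega1)"
      unfolding omega1_def using cardSuc_finite[OF natLeq_Card_order] inf by simp
    then obtain \<xi> where "\<xi> \<in> Field omega1" "\<mu> \<noteq> \<xi>" "(\<mu>, \<xi>) \<in> omega1"
      using infinite_Card_order_limit[OF omega1_Card_order] \<mu> by blast
    then show "d \<in> (\<Union>\<xi>\<in>Field omega1. ?Y \<xi>)"
      using \<mu> by (auto simp: underS_def)
  qed
  moreover have "|D| \<le>o natLeq"
  proof -
    obtain f :: "_ \<Rightarrow> nat" where "inj_on f D"
      using D(2) by (auto simp: countable_def)
    then have "|D| \<le>o |UNIV :: nat set|"
      by (rule card_of_ordLeqI) simp
    then show ?thesis
      by (rule ordLeq_ordIso_trans[OF _ card_of_nat])
  qed
  ultimately show ?thesis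
    using cardSuc_UNION[OF natLeq_Card_order inf] unfolding omega1_def by blast
qed

theorem proposition6p5:
  fixes X :: "((nat \<Rightarrow> real) \<Rightarrow> real) topology"
  assumes "basic_Novak_space X"
  shows "Staeckel_compact X"
proof -
  obtain S Xs where S: "S \<subseteq> topspace beta_N" "X = subtopology beta_N S"
      "S = (\<Union>\<xi>\<in>Field omega1. Xs \<xi>)"
    and Xs: "\<forall>\<xi>\<in>Field omega1.
      (UNIV :: nat set) \<lesssim> Xs \<xi> \<and> Xs \<xi> \<lesssim> (UNIV :: nat set set) \<and>
      Xs \<xi> \<inter> (\<Union>\<mu>\<in>underS omega1 \<xi>. Xs \<mu>) = {} \<and>
      (\<forall>A. A \<subseteq> (\<Union>\<mu>\<in>underS omega1 \<xi>. Xs \<mu>) \<and> infinite A \<longrightarrow>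
           Xs \<xi> \<inter> beta_N derived_set_of A \<noteq> {})"
    using assms unfolding basic_Novak_space_def by (elim exE conjE) (rule that, assumption+)
  have card: "Xs \<xi> \<lesssim> (UNIV :: nat set set)" if "\<xi> \<in> Field omega1" for \<xi>
    using bspec[OF Xs that] by simp
  have lim: "Xs \<xi> \<inter> beta_N derived_set_of A \<noteq> {}"
    if "\<xi> \<in> Field omega1" "A \<subseteq> (\<Union>\<mu>\<in>underS omega1 \<xi>. Xs \<mu>)" "infinite A" for \<xi> A
    using bspec[OF Xs that(1)] that(2,3) by simp
  have "|S| \<le>o |UNIV :: nat set set|"
    unfolding S(3)
  proof (rule card_of_UNION_ordLeq_infinite)
    show "\<forall>\<xi>\<in>Field omega1. |Xs \<xi>| \<le>o |UNIV :: nat set set|"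
      using card by (auto simp: lepoll_def card_of_ordLeq[symmetric])
  qed (auto simp: omega1_ordLeq_continuum Finite_Set.finite_set)
  moreover have topX: "topspace X = S"
    using S(1,2) by (simp add: Int_absorb1)
  ultimately have cardX: "|topspace X| \<le>o |UNIV :: nat set set|"
    by simp
  have limS: "S \<inter> beta_N derived_set_of D \<noteq> {}"
    if D: "D \<subseteq> S" "countable D" "infinite D" for D
  proof -
    obtain \<xi> where \<xi>: "\<xi> \<in> Field omega1" "D \<subseteq> (\<Union>\<mu>\<in>underS omega1 \<xi>. Xs \<mu>)"
      using countable_subset_bounded[OF D(1)[unfolded S(3)] D(2)] by (elim bexE)
    have "Xs \<xi> \<subseteq> S"
      unfolding S(3) using \<xi>(1) by (rule UN_upper)
    then have "Xs \<xi> \<inter> beta_N derived_set_of D \<subseteq> S \<inter> beta_N derived_set_of D"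
      by (rule Int_mono) (rule subset_refl)
    with lim[OF \<xi> D(3)] show ?thesis
      by (metis subset_empty)
  qed
  show ?thesis
  proof (rule Staeckel_compact_if_many_limit_points[OF _ cardX])
    show "Hausdorff_space X"
      unfolding S(2) by (intro Hausdorff_space_subtopology Hausdorff_space_beta_N)
  next
    fix A assume A: "A \<subseteq> topspace X" "infinite A"
    then have "X derived_set_of A = S \<inter> beta_N derived_set_of A"
      unfolding topX unfolding S(2) by (simp add: derived_set_of_subtopology Int_absorb1)
    then show "|UNIV :: nat set set| \<le>o |X derived_set_of A|"
      using continuum_many_limit_points[OF S(1) limS A[unfolded topX]] by simp
  qed
qed

end
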